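(* Let $A$ be a unital associative algebra over a field $k$, $E$ a $k$-vector space which contains $A$ as a subspace and $V$ a complement of $A$ in $E$. Then: (1) $\equiv$ is an equivalence relation on the set $\mathcal{AE}(A,V)$ of all algebra extending structures of $A$ through $V$. If $\mathcal{AH}^2_A(V,A):=\mathcal{AE}(A,V)/\equiv$, then the map $$\mathcal{AH}^2_A(V,A)\to \mathrm{Extd}(E,A),\qquad \overline{(\triangleleft,\triangleright,\leftharpoonup,\rightharpoonup,f,\cdot)}\longmapsto A\ltimes V$$ is a bijection. (2) $\approx$ is an equivalence relation on $\mathcal{AE}(A,V)$. If $\mathcal{AH}^2(V,A):=\mathcal{AE}(A,V)/\approx$, then the map $$\mathcal{AH}^2(V,A)\to \mathrm{Extd}'(E,A),\qquad \overline{\overline{(\triangleleft,\triangleright,\leftharpoonup,\rightharpoonup,f,\cdot)}}\longmapsto A\ltimes V$$ is a bijection. Here $\overline{(\cdots)}$ and $\overline{\overline{(\cdots)}}$ denote the classes with respect to $\equiv$ and $\approx$ respectively, and $A\ltimes V$ stands for the class of the algebra structure on $E$ obtained from the unified product through the linear isomorphism $A\times V\cong E$, $(a,x)\mapsto a+x$.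
   Context: All vector spaces, linear and bilinear maps are over an arbitrary field $k$. "Algebra" means unital associative $k$-algebra; subalgebras contain the unit and algebra maps preserve units. Classifying sets. Let $\pi:E=A\oplus V\to V$ be the canonical projection. A linear map $\varphi:E\to E$ stabilizes $A$ if $\varphi(a)=a$ for all $a\in A$, and co-stabilizes $V$ if $\pi\circ\varphi=\pi$. Two algebra structures on $E$ containing $A$ as a subalgebra are equivalent if there is an algebra isomorphism between them that stabilizes $A$; they are cohomologous if there is an algebra isomorphism between them that stabilizes $A$ and co-stabilizes $V$. $\mathrm{Extd}(E,A)$ (resp. $\mathrm{Extd}'(E,A)$) is the set of equivalence (resp. cohomology) classes of algebra structures on $E$ containing $A$ as a subalgebra. Extending structures. An extending datum of $A$ through $V$ is a system $\Omega(A,V)=(\triangleleft,\triangleright,\leftharpoonup,\rightharpoonup,f,\cdot)$ of six bilinear maps $\triangleleft:V\times A\to V$, $\triangleright:V\times A\to A$, $\leftharpoonup:A\times V\to A$, $\rightharpoonup:A\times V\to V$, $f:V\times V\to A$, $\cdot:V\times V\to V$. Let $A\ltimes V$ be the vector space $A\times V$ with multiplication $$(a,x)\bullet(b,y)=\bigl(ab+a\leftharpoonup y+x\triangleright b+f(x,y),\ a\rightharpoonup y+x\triangleleft b+x\cdot y\bigr).$$ If this is associative with unit $(1_A,0_V)$, then $\Omega(A,V)$ is called an algebra extending structure of $A$ through $V$ and $A\ltimes V$ the associated unified product. $\mathcal{AE}(A,V)$ is the set of all algebra extending structures of $A$ through $V$. Relation $\equiv$. $\Omega(A,V)=(\triangleleft,\triangleright,\leftharpoonup,\rightharpoonup,f,\cdot)\equiv\Omega'(A,V)=(\triangleleft',\triangleright',\leftharpoonup',\rightharpoonup',f',\cdot')$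 if there exist a linear map $r:V\to A$ and a linear automorphism $v$ of $V$ such that, writing $w=v^{-1}$, for all $a\in A$, $x,y\in V$: $a\rightharpoonup' x=v(a\rightharpoonup w(x))$; $a\leftharpoonup' x=r(a\rightharpoonup w(x))-a\,r(w(x))+a\leftharpoonup w(x)$; $x\triangleleft' a=v(w(x)\triangleleft a)$; $x\triangleright' a=r(w(x)\triangleleft a)-r(w(x))\,a+w(x)\triangleright a$; $x\cdot' y=v(w(x)\cdot w(y))-v\bigl(r(w(x))\rightharpoonup w(y)\bigr)-v\bigl(w(x)\triangleleft r(w(y))\bigr)$; $f'(x,y)=r(w(x)\cdot w(y))+f(w(x),w(y))-r\bigl(r(w(x))\rightharpoonup w(y)\bigr)-r(w(x))\leftharpoonup w(y)-r\bigl(w(x)\triangleleft r(w(y))\bigr)+r(w(x))\,r(w(y))-w(x)\triangleright r(w(y))$. Relation $\approx$. $\Omega(A,V)\approx\Omega'(A,V)$ if $\triangleleft'=\triangleleft$, $\rightharpoonup'=\rightharpoonup$ and there exists a linear map $r:V\to A$ such that for all $a\in A$, $x,y\in V$: $a\leftharpoonup' x=r(a\rightharpoonup x)-a\,r(x)+a\leftharpoonup x$; $x\triangleright' a=r(x\triangleleft a)-r(x)\,a+x\triangleright a$; $x\cdot' y=x\cdot y-r(x)\rightharpoonup y-x\triangleleft r(y)$; $f'(x,y)=r(x\cdot y)+f(x,y)-r\bigl(r(x)\rightharpoonup y\bigr)-r(x)\leftharpoonup y-r\bigl(x\triangleleft r(y)\bigr)+r(x)r(y)-x\triangleright r(y)$.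 *)

theory Defs
  imports "HOL.Vector_Spaces" "HOL-Library.FuncSet"
begin

text \<open>
  The ambient space \<open>E\<close> is the whole type \<open>'e\<close>, a vector space over the field \<open>'k\<close> via
  \<open>scale\<close>; \<open>A\<close> and \<open>V\<close> are subsets of it, so maps between them are functions on \<open>'e\<close> of which
  only the values on the relevant subset matter.
\<close>

definition linear_map_on ::
  "('k::field \<Rightarrow> 'e::ab_group_add \<Rightarrow> 'e) \<Rightarrow> 'e set \<Rightarrow> 'e set \<Rightarrow> ('e \<Rightarrow> 'e) \<Rightarrow> bool" where
  "linear_map_on scale U W h \<longleftrightarrow>
     h \<in> U \<rightarrow> W \<and>
     (\<forall>x\<in>U. \<forall>y\<in>U. h (x + y) = h x + h y) \<and>
     (\<forall>c. \<forall>x\<in>U. h (scale c x) = scale c (h x))"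

definition bilinear_map_on ::
  "('k::field \<Rightarrow> 'e::ab_group_add \<Rightarrow> 'e) \<Rightarrow> 'e set \<Rightarrow> 'e set \<Rightarrow> 'e set \<Rightarrow> ('e \<Rightarrow> 'e \<Rightarrow> 'e) \<Rightarrow> bool"
  where
  "bilinear_map_on scale U W X b \<longleftrightarrow>
     (\<forall>x\<in>U. linear_map_on scale W X (b x)) \<and>
     (\<forall>y\<in>W. linear_map_on scale U X (\<lambda>x. b x y))"

definition unital_algebra_on ::
  "('k::field \<Rightarrow> 'e::ab_group_add \<Rightarrow> 'e) \<Rightarrow> 'e set \<Rightarrow> ('e \<Rightarrow> 'e \<Rightarrow> 'e) \<Rightarrow> 'e \<Rightarrow> bool" where
  "unital_algebra_on scale S mult u \<longleftrightarrow>
     bilinear_map_on scale S S S mult \<and>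
     (\<forall>x\<in>S. \<forall>y\<in>S. \<forall>z\<in>S. mult (mult x y) z = mult x (mult y z)) \<and>
     u \<in> S \<and> (\<forall>x\<in>S. mult u x = x \<and> mult x u = x)"

text \<open>
  The six maps of an extending datum, with the names \<open>vact_right\<close> for \<open>V \<times> A \<rightarrow> V\<close>,
  \<open>vact_alg\<close> for \<open>V \<times> A \<rightarrow> A\<close>, \<open>aact_alg\<close> for \<open>A \<times> V \<rightarrow> A\<close>, \<open>aact_left\<close> for
  \<open>A \<times> V \<rightarrow> V\<close>, \<open>cocyc\<close> for \<open>f : V \<times> V \<rightarrow> A\<close> and \<open>vmult\<close> for \<open>V \<times> V \<rightarrow> V\<close>.
\<close>

record 'e ext_datum =
  vact_right :: "'e \<Rightarrow> 'e \<Rightarrow> 'e"  (infixl "\<triangleleft>\<index>" 70)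
  vact_alg :: "'e \<Rightarrow> 'e \<Rightarrow> 'e"  (infixl "\<triangleright>\<index>" 70)
  aact_alg :: "'e \<Rightarrow> 'e \<Rightarrow> 'e"  (infixl "\<leftharpoonup>\<index>" 70)
  aact_left :: "'e \<Rightarrow> 'e \<Rightarrow> 'e"  (infixl "\<rightharpoonup>\<index>" 70)
  cocyc :: "'e \<Rightarrow> 'e \<Rightarrow> 'e"
  vmult :: "'e \<Rightarrow> 'e \<Rightarrow> 'e"  (infixl "\<cdot>\<index>" 70)

text \<open>
  Bilinear maps \<open>U \<times> W \<rightarrow> X\<close> as objects: the value off \<open>U \<times> W\<close> is fixed, so that equality of
  functions is equality of maps on \<open>U \<times> W\<close>.
\<close>

definition bilinear_maps ::
  "('k::field \<Rightarrow> 'e::ab_group_add \<Rightarrow> 'e) \<Rightarrow> 'e set \<Rightarrow> 'e set \<Rightarrow> 'e set \<Rightarrow> ('e \<Rightarrow> 'e \<Rightarrow> 'e) set"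
  where
  "bilinear_maps scale U W X =
     {b. bilinear_map_on scale U W X b \<and> case_prod b \<in> extensional (U \<times> W)}"

context
  fixes scale :: "'k::field \<Rightarrow> 'e::ab_group_add \<Rightarrow> 'e"
    and A V :: "'e set"
    and mult :: "'e \<Rightarrow> 'e \<Rightarrow> 'e"  (infixl "\<odot>" 70)
    and one :: 'e
begin

definition extending_datum :: "'e ext_datum \<Rightarrow> bool" where
  "extending_datum \<Omega> \<longleftrightarrow>
     vact_right \<Omega> \<in> bilinear_maps scale V A V \<and>
     vact_alg \<Omega> \<in> bilinear_maps scale V A A \<and>
     aact_alg \<Omega> \<in> bilinear_maps scale A V A \<and>
     aact_left \<Omega> \<in> bilinear_maps scale A V V \<and>
     cocyc \<Omega> \<in> bilinear_maps scale V V A \<and>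
     vmult \<Omega> \<in> bilinear_maps scale V V V"

definition unified_mult :: "'e ext_datum \<Rightarrow> 'e \<times> 'e \<Rightarrow> 'e \<times> 'e \<Rightarrow> 'e \<times> 'e" where
  "unified_mult \<Omega> = (\<lambda>(a, x) (b, y).
     (a \<odot> b + a \<leftharpoonup>\<^bsub>\<Omega>\<^esub> y + x \<triangleright>\<^bsub>\<Omega>\<^esub> b + cocyc \<Omega> x y,
      a \<rightharpoonup>\<^bsub>\<Omega>\<^esub> y + x \<triangleleft>\<^bsub>\<Omega>\<^esub> b + x \<cdot>\<^bsub>\<Omega>\<^esub> y))"

definition AE :: "'e ext_datum set" where
  "AE = {\<Omega>. extending_datum \<Omega> \<and>
     (\<forall>p\<in>A \<times> V. \<forall>q\<in>A \<times> V. \<forall>t\<in>A \<times> V.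
        unified_mult \<Omega> (unified_mult \<Omega> p q) t = unified_mult \<Omega> p (unified_mult \<Omega> q t)) \<and>
     (\<forall>p\<in>A \<times> V. unified_mult \<Omega> (one, 0) p = p \<and> unified_mult \<Omega> p (one, 0) = p)}"

definition AE_equiv :: "('e ext_datum \<times> 'e ext_datum) set" where
  "AE_equiv = {(\<Omega>, \<Omega>'). \<Omega> \<in> AE \<and> \<Omega>' \<in> AE \<and>
     (\<exists>r v. linear_map_on scale V A r \<and> linear_map_on scale V V v \<and> bij_betw v V V \<and>
       (let w = the_inv_into V v in
         (\<forall>a\<in>A. \<forall>x\<in>V. a \<rightharpoonup>\<^bsub>\<Omega>'\<^esub> x = v (a \<rightharpoonup>\<^bsub>\<Omega>\<^esub> w x)) \<and>
         (\<forall>a\<in>A. \<forall>x\<in>V. a \<leftharpoonup>\<^bsub>\<Omega>'\<^esub> x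
            = r (a \<rightharpoonup>\<^bsub>\<Omega>\<^esub> w x) - a \<odot> r (w x) + a \<leftharpoonup>\<^bsub>\<Omega>\<^esub> w x) \<and>
         (\<forall>a\<in>A. \<forall>x\<in>V. x \<triangleleft>\<^bsub>\<Omega>'\<^esub> a = v (w x \<triangleleft>\<^bsub>\<Omega>\<^esub> a)) \<and>
         (\<forall>a\<in>A. \<forall>x\<in>V. x \<triangleright>\<^bsub>\<Omega>'\<^esub> a
            = r (w x \<triangleleft>\<^bsub>\<Omega>\<^esub> a) - r (w x) \<odot> a + w x \<triangleright>\<^bsub>\<Omega>\<^esub> a) \<and>
         (\<forall>x\<in>V. \<forall>y\<in>V. x \<cdot>\<^bsub>\<Omega>'\<^esub> y
            = v (w x \<cdot>\<^bsub>\<Omega>\<^esub> w y) - v (r (w x) \<rightharpoonup>\<^bsub>\<Omega>\<^esub> w y)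
              - v (w x \<triangleleft>\<^bsub>\<Omega>\<^esub> r (w y))) \<and>
         (\<forall>x\<in>V. \<forall>y\<in>V. cocyc \<Omega>' x y
            = r (w x \<cdot>\<^bsub>\<Omega>\<^esub> w y) + cocyc \<Omega> (w x) (w y)
              - r (r (w x) \<rightharpoonup>\<^bsub>\<Omega>\<^esub> w y) - r (w x) \<leftharpoonup>\<^bsub>\<Omega>\<^esub> w y
              - r (w x \<triangleleft>\<^bsub>\<Omega>\<^esub> r (w y)) + r (w x) \<odot> r (w y)
              - w x \<triangleright>\<^bsub>\<Omega>\<^esub> r (w y))))}"

definition AE_cohom :: "('e ext_datum \<times> 'e ext_datum) set" where
  "AE_cohom = {(\<Omega>, \<Omega>'). \<Omega> \<in> AE \<and> \<Omega>' \<in> AE \<and>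
     vact_right \<Omega>' = vact_right \<Omega> \<and> aact_left \<Omega>' = aact_left \<Omega> \<and>
     (\<exists>r. linear_map_on scale V A r \<and>
       (\<forall>a\<in>A. \<forall>x\<in>V. a \<leftharpoonup>\<^bsub>\<Omega>'\<^esub> x
          = r (a \<rightharpoonup>\<^bsub>\<Omega>\<^esub> x) - a \<odot> r x + a \<leftharpoonup>\<^bsub>\<Omega>\<^esub> x) \<and>
       (\<forall>a\<in>A. \<forall>x\<in>V. x \<triangleright>\<^bsub>\<Omega>'\<^esub> a
          = r (x \<triangleleft>\<^bsub>\<Omega>\<^esub> a) - r x \<odot> a + x \<triangleright>\<^bsub>\<Omega>\<^esub> a) \<and>
       (\<forall>x\<in>V. \<forall>y\<in>V. x \<cdot>\<^bsub>\<Omega>'\<^esub> y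
          = x \<cdot>\<^bsub>\<Omega>\<^esub> y - r x \<rightharpoonup>\<^bsub>\<Omega>\<^esub> y - x \<triangleleft>\<^bsub>\<Omega>\<^esub> r y) \<and>
       (\<forall>x\<in>V. \<forall>y\<in>V. cocyc \<Omega>' x y
          = r (x \<cdot>\<^bsub>\<Omega>\<^esub> y) + cocyc \<Omega> x y - r (r x \<rightharpoonup>\<^bsub>\<Omega>\<^esub> y)
            - r x \<leftharpoonup>\<^bsub>\<Omega>\<^esub> y - r (x \<triangleleft>\<^bsub>\<Omega>\<^esub> r y) + r x \<odot> r y
            - x \<triangleright>\<^bsub>\<Omega>\<^esub> r y))}"

text \<open>\<open>split_AV\<close> and \<open>proj_V\<close> are meaningful only when \<open>E = A \<oplus> V\<close>.\<close>

definition join :: "'e \<times> 'e \<Rightarrow> 'e" where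
  "join = (\<lambda>(a, x). a + x)"

definition split_AV :: "'e \<Rightarrow> 'e \<times> 'e" where
  "split_AV = the_inv_into (A \<times> V) join"

definition proj_V :: "'e \<Rightarrow> 'e" where
  "proj_V e = snd (split_AV e)"

definition unified_on_E :: "'e ext_datum \<Rightarrow> 'e \<Rightarrow> 'e \<Rightarrow> 'e" where
  "unified_on_E \<Omega> e e' = join (unified_mult \<Omega> (split_AV e) (split_AV e'))"

text \<open>
  Algebra structures on \<open>E\<close> containing \<open>A\<close> as a subalgebra, given by their multiplication.
  As subalgebras contain the unit, the unit of such a structure is that of \<open>A\<close>.
\<close>

definition alg_structures :: "('e \<Rightarrow> 'e \<Rightarrow> 'e) set" where
  "alg_structures = {\<mu>. unital_algebra_on scale UNIV \<mu> one \<and> (\<forall>a\<in>A. \<forall>b\<in>A. \<mu> a b = a \<odot> b)}"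

definition stabilizes :: "('e \<Rightarrow> 'e) \<Rightarrow> bool" where
  "stabilizes \<phi> \<longleftrightarrow> (\<forall>a\<in>A. \<phi> a = a)"

definition co_stabilizes :: "('e \<Rightarrow> 'e) \<Rightarrow> bool" where
  "co_stabilizes \<phi> \<longleftrightarrow> proj_V \<circ> \<phi> = proj_V"

definition algebra_iso :: "('e \<Rightarrow> 'e \<Rightarrow> 'e) \<Rightarrow> ('e \<Rightarrow> 'e \<Rightarrow> 'e) \<Rightarrow> ('e \<Rightarrow> 'e) \<Rightarrow> bool" where
  "algebra_iso \<mu> \<mu>' \<phi> \<longleftrightarrow>
     Vector_Spaces.linear scale scale \<phi> \<and> bij \<phi> \<and>
     (\<forall>e e'. \<phi> (\<mu> e e') = \<mu>' (\<phi> e) (\<phi> e')) \<and> \<phi> one = one"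

definition alg_equivalent :: "(('e \<Rightarrow> 'e \<Rightarrow> 'e) \<times> ('e \<Rightarrow> 'e \<Rightarrow> 'e)) set" where
  "alg_equivalent = {(\<mu>, \<mu>'). \<mu> \<in> alg_structures \<and> \<mu>' \<in> alg_structures \<and>
     (\<exists>\<phi>. algebra_iso \<mu> \<mu>' \<phi> \<and> stabilizes \<phi>)}"

definition alg_cohomologous :: "(('e \<Rightarrow> 'e \<Rightarrow> 'e) \<times> ('e \<Rightarrow> 'e \<Rightarrow> 'e)) set" where
  "alg_cohomologous = {(\<mu>, \<mu>'). \<mu> \<in> alg_structures \<and> \<mu>' \<in> alg_structures \<and>
     (\<exists>\<phi>. algebra_iso \<mu> \<mu>' \<phi> \<and> stabilizes \<phi> \<and> co_stabilizes \<phi>)}"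

definition Extd :: "('e \<Rightarrow> 'e \<Rightarrow> 'e) set set" where
  "Extd = alg_structures // alg_equivalent"

definition Extd' :: "('e \<Rightarrow> 'e \<Rightarrow> 'e) set set" where
  "Extd' = alg_structures // alg_cohomologous"

definition AH2_A :: "'e ext_datum set set" where
  "AH2_A = AE // AE_equiv"

definition AH2 :: "'e ext_datum set set" where
  "AH2 = AE // AE_cohom"

end

end

theory Submission
  imports Defs
begin

text \<open>
  An extending datum is the same thing as an algebra structure on \<open>E\<close> containing \<open>A\<close>: the six
  maps are the components, along \<open>E = A \<oplus> V\<close>, of the multiplication restricted to
  \<open>V \<times> A\<close>, \<open>A \<times> V\<close> and \<open>V \<times> V\<close>. Linear maps \<open>\<phi>\<close> that stabilize \<open>A\<close> correspond to pairs \<open>(r, v)\<close>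
  through \<open>\<phi> (a + x) = a + r x + v x\<close>, where \<open>\<phi>\<close> is bijective iff \<open>v\<close> is, and co-stabilizes
  \<open>V\<close> iff \<open>v\<close> is the identity; by bilinearity \<open>\<phi>\<close> is multiplicative iff \<open>r, v\<close> satisfy the
  six equations defining the relation on data. So both relations on data are pulled back along
  the bijection from the relations on algebra structures.
\<close>

section \<open>Linear and bilinear maps on subspaces\<close>

lemma linear_map_onD:
  assumes "linear_map_on scale U W h"
  shows "x \<in> U \<Longrightarrow> h x \<in> W"
    and "x \<in> U \<Longrightarrow> y \<in> U \<Longrightarrow> h (x + y) = h x + h y"
    and "x \<in> U \<Longrightarrow> h (scale c x) = scale c (h x)"
  using assms by (auto simp: linear_map_on_def)

lemma linear_map_on_comp:
  assumes "linear_map_on scale U W h" "linear_map_on scale W X g"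
  shows "linear_map_on scale U X (\<lambda>x. g (h x))"
  using assms by (auto simp: linear_map_on_def Pi_iff)

lemma linear_map_on_subset:
  assumes "linear_map_on scale U W h" "U' \<subseteq> U" "W \<subseteq> W'"
  shows "linear_map_on scale U' W' h"
  using assms by (auto simp: linear_map_on_def Pi_iff subset_iff)

lemma bilinear_map_onD:
  assumes "bilinear_map_on scale U W X b"
  shows "x \<in> U \<Longrightarrow> y \<in> W \<Longrightarrow> b x y \<in> X"
    and "x \<in> U \<Longrightarrow> x' \<in> U \<Longrightarrow> y \<in> W \<Longrightarrow> b (x + x') y = b x y + b x' y"
    and "x \<in> U \<Longrightarrow> y \<in> W \<Longrightarrow> y' \<in> W \<Longrightarrow> b x (y + y') = b x y + b x y'"
    and "x \<in> U \<Longrightarrow> y \<in> W \<Longrightarrow> b (scale c x) y = scale c (b x y)"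
    and "x \<in> U \<Longrightarrow> y \<in> W \<Longrightarrow> b x (scale c y) = scale c (b x y)"
    and "0 \<in> U \<Longrightarrow> y \<in> W \<Longrightarrow> b 0 y = 0"
    and "x \<in> U \<Longrightarrow> 0 \<in> W \<Longrightarrow> b x 0 = 0"
proof -
  note D = assms[unfolded bilinear_map_on_def linear_map_on_def]
  show "x \<in> U \<Longrightarrow> y \<in> W \<Longrightarrow> b x y \<in> X"
    and "x \<in> U \<Longrightarrow> x' \<in> U \<Longrightarrow> y \<in> W \<Longrightarrow> b (x + x') y = b x y + b x' y"
    and "x \<in> U \<Longrightarrow> y \<in> W \<Longrightarrow> y' \<in> W \<Longrightarrow> b x (y + y') = b x y + b x y'"
    and "x \<in> U \<Longrightarrow> y \<in> W \<Longrightarrow> b (scale c x) y = scale c (b x y)"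
    and "x \<in> U \<Longrightarrow> y \<in> W \<Longrightarrow> b x (scale c y) = scale c (b x y)"
    using D by blast+
  show "b 0 y = 0" if "0 \<in> U" "y \<in> W"
  proof -
    have "b (0 + 0) y = b 0 y + b 0 y" using D that by blast
    then show ?thesis by simp
  qed
  show "b x 0 = 0" if "x \<in> U" "0 \<in> W"
  proof -
    have "b x (0 + 0) = b x 0 + b x 0" using D that by blast
    then show ?thesis by simp
  qed
qed

text \<open>With projections as \<open>p\<close> and \<open>q\<close> this extends the maps of a
  datum to all of E; with inclusions as \<open>p\<close> and \<open>q\<close> and a projection as
  \<open>s\<close> it cuts a multiplication on E into components.\<close>

lemma bilinear_map_on_comp:
  assumes "bilinear_map_on scale U W X b"
    and "linear_map_on scale U' U p" "linear_map_on scale W' W q" "linear_map_on scale X X' s"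
  shows "bilinear_map_on scale U' W' X' (\<lambda>x y. s (b (p x) (q y)))"
  using assms unfolding bilinear_map_on_def linear_map_on_def Pi_iff by simp

text \<open>Subspaces are closed under sums and multiples, so the linearity laws never reach the
  default branch; that branch only serves extensionality.\<close>

lemma bilinear_map_on_restrict_mem:
  assumes "bilinear_map_on scale U W X b"
    and "module.subspace scale U" "module.subspace scale W" "module scale"
  shows "(\<lambda>x y. if x \<in> U \<and> y \<in> W then b x y else undefined) \<in> bilinear_maps scale U W X"
  using assms
  by (auto simp: bilinear_maps_def bilinear_map_on_def linear_map_on_def extensional_def Pi_iff
      module.subspace_add module.subspace_scale)

text \<open>Extensionality fixes the values off \<open>U \<times> W\<close>, so only those on it can
  differ.\<close>

lemma bilinear_maps_eqI:
  assumes "b \<in> bilinear_maps scale U W X" "b' \<in> bilinear_maps scale U W X"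
    and "\<And>x y. x \<in> U \<Longrightarrow> y \<in> W \<Longrightarrow> b x y = b' x y"
  shows "b = b'"
proof -
  have "case_prod b = case_prod b'"
    using assms by (intro extensionalityI[of _ "U \<times> W"]) (auto simp: bilinear_maps_def)
  then show ?thesis by (metis case_prod_curry curry_case_prod)
qed

section \<open>Quotients by a relation pulled back along a bijection\<close>

text \<open>The map \<open>F\<close> on classes is the direct image under \<open>M\<close>: it sends
  the \<open>R\<close>-class of \<open>x\<close> onto the \<open>R'\<close>-class of
  \<open>M x\<close>. Both halves of the theorem are instances.\<close>

lemma quotient_bij_of_pullback:
  assumes M: "bij_betw M S T" and R': "equiv T R'"
    and R: "R = {(x, y). x \<in> S \<and> y \<in> S \<and> (M x, M y) \<in> R'}"
  shows "equiv S R \<and> (\<exists>F. (\<forall>x\<in>S. F (R `` {x}) = R' `` {M x}) \<and> bij_betw F (S // R) (T // R'))"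
proof -
  have MT: "M x \<in> T" if "x \<in> S" for x
    using M that by (auto simp: bij_betw_def)
  have R'T: "R' \<subseteq> T \<times> T"
    using R' by (auto simp: equiv_def refl_on_def)
  have "sym R" and "trans R"
    using R' unfolding R equiv_def
    by (auto intro!: symI transI elim: symE transE dest: symD transD)
  moreover have "refl_on S R" "R \<subseteq> S \<times> S"
    using R' MT unfolding R equiv_def refl_on_def by auto
  ultimately have eq: "equiv S R" by (simp add: equiv_def)
  have img: "M ` (R `` {x}) = R' `` {M x}" if "x \<in> S" for x
  proof -
    \<comment> \<open>Every element of the \<open>R'\<close>-class lies in \<open>T\<close> and so
      has a preimage in \<open>S\<close>, which makes the image the whole class.\<close>
    have "T = M ` S" using M by (auto simp: bij_betw_def)
    then show ?thesis using that R'T unfolding R by auto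
  qed
  have "bij_betw ((`) M) (S // R) (T // R')"
  proof (rule bij_betw_imageI)
    \<comment> \<open>Classes are subsets of \<open>S\<close>, and direct images under a map
      injective on \<open>S\<close> distinguish such subsets.\<close>
    have "S // R \<subseteq> Pow S"
      using eq by (auto simp: quotient_def equiv_def)
    then show "inj_on ((`) M) (S // R)"
      using M by (meson bij_betw_def inj_on_image_Pow inj_on_subset)
    show "(`) M ` (S // R) = T // R'"
    proof -
      have "(`) M ` (S // R) = (\<lambda>x. R' `` {M x}) ` S"
        using img by (auto simp: quotient_def image_iff)
      also have "\<dots> = (\<lambda>y. R' `` {y}) ` T"
        using M by (auto simp: bij_betw_def)
      finally show ?thesis by (auto simp: quotient_def)
    qed
  qed
  with eq img show ?thesis by blast
qed

section \<open>The decomposition of E and its two projections\<close>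

locale complemented_subalgebra = vector_space scale
  for scale :: "'k::field \<Rightarrow> 'e::ab_group_add \<Rightarrow> 'e" +
  fixes A V :: "'e set"
    and mult :: "'e \<Rightarrow> 'e \<Rightarrow> 'e"  (infixl "\<odot>" 70)
    and one :: 'e
  assumes subA: "subspace A"
    and algA: "unital_algebra_on scale A mult one"
    and subV: "subspace V"
    and disj: "A \<inter> V = {0}"
    and span_E: "{a + x | a x. a \<in> A \<and> x \<in> V} = UNIV"
begin

abbreviation "AE' \<equiv> AE scale A V mult one"
abbreviation "algs \<equiv> alg_structures scale A mult one"
abbreviation "datum \<equiv> extending_datum scale A V"
abbreviation "uE \<equiv> unified_on_E A V mult"

text \<open>The counterpart of \<open>proj_V\<close>; the pair of projections replaces
  \<open>split_AV\<close> in all computations.\<close>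

definition pA :: "'e \<Rightarrow> 'e" where "pA e = fst (split_AV A V e)"
abbreviation pV :: "'e \<Rightarrow> 'e" where "pV \<equiv> proj_V A V"

lemma zero_mem [simp]: "0 \<in> A" "0 \<in> V"
  using subA subV by (auto simp: subspace_0)

lemma add_mem [simp]:
  "a \<in> A \<Longrightarrow> b \<in> A \<Longrightarrow> a + b \<in> A" "x \<in> V \<Longrightarrow> y \<in> V \<Longrightarrow> x + y \<in> V"
  using subA subV by (auto simp: subspace_add)

lemma diff_mem [simp]:
  "a \<in> A \<Longrightarrow> b \<in> A \<Longrightarrow> a - b \<in> A" "x \<in> V \<Longrightarrow> y \<in> V \<Longrightarrow> x - y \<in> V"
  using subA subV by (auto simp: subspace_diff)

lemma scale_mem [simp]: "a \<in> A \<Longrightarrow> scale c a \<in> A" "x \<in> V \<Longrightarrow> scale c x \<in> V"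
  using subA subV by (auto simp: subspace_scale)

lemma one_mem [simp]: "one \<in> A"
  and bilinear_mult: "bilinear_map_on scale A A A (\<odot>)"
  using algA by (auto simp: unital_algebra_on_def)

text \<open>The vector \<open>a - b = y - x\<close> lies in both summands and hence
  vanishes.\<close>

lemma direct_sum_eq_iff:
  assumes "a \<in> A" "b \<in> A" "x \<in> V" "y \<in> V"
  shows "a + x = b + y \<longleftrightarrow> a = b \<and> x = y"
proof
  assume eq: "a + x = b + y"
  then have "a - b = y - x" by (simp add: algebra_simps)
  then have "a - b \<in> A \<inter> V"
    using assms by (metis IntI diff_mem)
  with disj have "a - b = 0" by simp
  with eq show "a = b \<and> x = y" by simp
qed simp

lemma inj_join: "inj_on join (A \<times> V)"
  by (auto simp: inj_on_def join_def direct_sum_eq_iff)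

lemma split_join: "a \<in> A \<Longrightarrow> x \<in> V \<Longrightarrow> split_AV A V (a + x) = (a, x)"
  using the_inv_into_f_f[OF inj_join, of "(a, x)"] by (simp add: split_AV_def join_def)

lemma proj_add [simp]:
  assumes "a \<in> A" "x \<in> V"
  shows "pA (a + x) = a" "pV (a + x) = x"
  using assms by (simp_all add: pA_def proj_V_def split_join)

lemma proj_cases:
  obtains a x where "a \<in> A" "x \<in> V" "e = a + x"
proof -
  have "e \<in> {a + x | a x. a \<in> A \<and> x \<in> V}" using span_E by simp
  then show ?thesis using that by blast
qed

lemma pA_mem [simp]: "pA e \<in> A" and pV_mem [simp]: "pV e \<in> V" and pA_add_pV: "pA e + pV e = e"
  by (cases e rule: proj_cases; simp)+

lemma proj_A [simp]: "a \<in> A \<Longrightarrow> pA a = a" "a \<in> A \<Longrightarrow> pV a = 0"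
  using proj_add[of a 0] by auto

lemma proj_V [simp]: "x \<in> V \<Longrightarrow> pA x = 0" "x \<in> V \<Longrightarrow> pV x = x"
  using proj_add[of 0 x] by auto

text \<open>This turns one identity in E into a pair of equations, one in A and one in V.\<close>

lemma eq_iff_proj: "e = e' \<longleftrightarrow> pA e = pA e' \<and> pV e = pV e'"
  by (metis pA_add_pV)

lemma split_AV_eq: "split_AV A V e = (pA e, pV e)"
  by (simp add: pA_def proj_V_def)

text \<open>Adding two decompositions gives a decomposition of the sum, and decompositions are
  unique.\<close>

lemma proj_plus [simp]: "pA (e + e') = pA e + pA e'" "pV (e + e') = pV e + pV e'"
proof -
  have "e + e' = (pA e + pA e') + (pV e + pV e')"
    using pA_add_pV[of e] pA_add_pV[of e'] by (metis add.assoc add.left_commute)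
  then show "pA (e + e') = pA e + pA e'" "pV (e + e') = pV e + pV e'"
    by (simp_all only: proj_add add_mem pA_mem pV_mem)
qed

lemma proj_scale [simp]: "pA (scale c e) = scale c (pA e)" "pV (scale c e) = scale c (pV e)"
proof -
  have "scale c e = scale c (pA e) + scale c (pV e)"
    by (metis pA_add_pV scale_right_distrib)
  then show "pA (scale c e) = scale c (pA e)" "pV (scale c e) = scale c (pV e)"
    by (simp_all only: proj_add scale_mem pA_mem pV_mem)
qed

lemma linear_pA: "linear_map_on scale UNIV A pA" and linear_pV: "linear_map_on scale UNIV V pV"
  by (simp_all add: linear_map_on_def)

lemma linear_incl: "linear_map_on scale U UNIV (\<lambda>x. x)"
  by (simp add: linear_map_on_def)

lemma bilinear_map_on_add:
  assumes "bilinear_map_on scale UNIV UNIV UNIV b" "bilinear_map_on scale UNIV UNIV UNIV c"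
  shows "bilinear_map_on scale UNIV UNIV UNIV (\<lambda>x y. b x y + c x y)"
  using assms
  by (auto simp: bilinear_map_on_def linear_map_on_def algebra_simps scale_right_distrib)

text \<open>Bridge between the library notion of linearity in \<open>algebra_iso\<close> and the
  relative one used for \<open>r\<close> and \<open>v\<close>.\<close>

lemma linear_iff_map_on: "Vector_Spaces.linear scale scale h \<longleftrightarrow> linear_map_on scale UNIV UNIV h"
  using vector_space_axioms
  by (auto simp: Vector_Spaces.linear_def module_hom_def module_hom_axioms_def linear_map_on_def
      module_iff_vector_space)

section \<open>The multiplication on E induced by a datum\<close>

lemma datumD:
  assumes "datum \<Omega>"
  shows "bilinear_map_on scale V A V (vact_right \<Omega>)" "bilinear_map_on scale V A A (vact_alg \<Omega>)"
    "bilinear_map_on scale A V A (aact_alg \<Omega>)" "bilinear_map_on scale A V V (aact_left \<Omega>)"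
    "bilinear_map_on scale V V A (cocyc \<Omega>)" "bilinear_map_on scale V V V (vmult \<Omega>)"
  using assms by (auto simp: extending_datum_def bilinear_maps_def)

lemmas mult_mem [simp] = bilinear_map_onD(1)[OF bilinear_mult]
lemmas mult_zero [simp] =
  bilinear_map_onD(6)[OF bilinear_mult zero_mem(1)] bilinear_map_onD(7)[OF bilinear_mult _ zero_mem(1)]

lemma datum_mem [simp]:
  assumes "datum \<Omega>"
  shows "x \<in> V \<Longrightarrow> a \<in> A \<Longrightarrow> x \<triangleleft>\<^bsub>\<Omega>\<^esub> a \<in> V" "x \<in> V \<Longrightarrow> a \<in> A \<Longrightarrow> x \<triangleright>\<^bsub>\<Omega>\<^esub> a \<in> A"
    "a \<in> A \<Longrightarrow> x \<in> V \<Longrightarrow> a \<leftharpoonup>\<^bsub>\<Omega>\<^esub> x \<in> A" "a \<in> A \<Longrightarrow> x \<in> V \<Longrightarrow> a \<rightharpoonup>\<^bsub>\<Omega>\<^esub> x \<in> V"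
    "x \<in> V \<Longrightarrow> y \<in> V \<Longrightarrow> cocyc \<Omega> x y \<in> A" "x \<in> V \<Longrightarrow> y \<in> V \<Longrightarrow> x \<cdot>\<^bsub>\<Omega>\<^esub> y \<in> V"
  using datumD[OF assms] by (auto intro: bilinear_map_onD(1))

lemma datum_zero [simp]:
  assumes "datum \<Omega>"
  shows "a \<in> A \<Longrightarrow> 0 \<triangleleft>\<^bsub>\<Omega>\<^esub> a = 0" "a \<in> A \<Longrightarrow> 0 \<triangleright>\<^bsub>\<Omega>\<^esub> a = 0"
    "a \<in> A \<Longrightarrow> a \<leftharpoonup>\<^bsub>\<Omega>\<^esub> 0 = 0" "a \<in> A \<Longrightarrow> a \<rightharpoonup>\<^bsub>\<Omega>\<^esub> 0 = 0"
    "x \<in> V \<Longrightarrow> x \<triangleleft>\<^bsub>\<Omega>\<^esub> 0 = 0" "x \<in> V \<Longrightarrow> x \<triangleright>\<^bsub>\<Omega>\<^esub> 0 = 0"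
    "x \<in> V \<Longrightarrow> 0 \<leftharpoonup>\<^bsub>\<Omega>\<^esub> x = 0" "x \<in> V \<Longrightarrow> 0 \<rightharpoonup>\<^bsub>\<Omega>\<^esub> x = 0"
    "x \<in> V \<Longrightarrow> cocyc \<Omega> 0 x = 0" "x \<in> V \<Longrightarrow> cocyc \<Omega> x 0 = 0"
    "x \<in> V \<Longrightarrow> 0 \<cdot>\<^bsub>\<Omega>\<^esub> x = 0" "x \<in> V \<Longrightarrow> x \<cdot>\<^bsub>\<Omega>\<^esub> 0 = 0"
  using datumD[OF assms] by (auto intro: bilinear_map_onD(6,7))

lemma unified_on_E_eq:
  "uE \<Omega> e e' = pA e \<odot> pA e' + pA e \<leftharpoonup>\<^bsub>\<Omega>\<^esub> pV e' + pV e \<triangleright>\<^bsub>\<Omega>\<^esub> pA e' + cocyc \<Omega> (pV e) (pV e')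
    + (pA e \<rightharpoonup>\<^bsub>\<Omega>\<^esub> pV e' + pV e \<triangleleft>\<^bsub>\<Omega>\<^esub> pA e' + pV e \<cdot>\<^bsub>\<Omega>\<^esub> pV e')"
  by (simp add: unified_on_E_def unified_mult_def split_AV_eq join_def)

text \<open>The product is a sum of seven terms, each being \<open>mult\<close> or one of the six
  maps, precomposed with projections and followed by an inclusion into E.\<close>

lemma bilinear_unified_on_E:
  assumes "datum \<Omega>"
  shows "bilinear_map_on scale UNIV UNIV UNIV (uE \<Omega>)"
proof -
  note D = datumD[OF assms]
  have eq: "uE \<Omega> = (\<lambda>e e'. pA e \<odot> pA e' + pA e \<leftharpoonup>\<^bsub>\<Omega>\<^esub> pV e' + pV e \<triangleright>\<^bsub>\<Omega>\<^esub> pA e' + cocyc \<Omega> (pV e) (pV e')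
    + (pA e \<rightharpoonup>\<^bsub>\<Omega>\<^esub> pV e' + pV e \<triangleleft>\<^bsub>\<Omega>\<^esub> pA e' + pV e \<cdot>\<^bsub>\<Omega>\<^esub> pV e'))"
    by (intro ext) (rule unified_on_E_eq)
  note c = bilinear_map_on_comp[OF _ _ _ linear_incl]
  show ?thesis
    unfolding eq
    by (intro bilinear_map_on_add c[OF bilinear_mult linear_pA linear_pA]
        c[OF D(1) linear_pV linear_pA] c[OF D(2) linear_pV linear_pA]
        c[OF D(3) linear_pA linear_pV] c[OF D(4) linear_pA linear_pV]
        c[OF D(5) linear_pV linear_pV] c[OF D(6) linear_pV linear_pV])
qed

lemma unified_mult_mem:
  assumes "datum \<Omega>" "p \<in> A \<times> V" "q \<in> A \<times> V"
  shows "unified_mult mult \<Omega> p q \<in> A \<times> V"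
  using assms by (auto simp: unified_mult_def)

lemma unified_on_E_join:
  assumes "p \<in> A \<times> V" "q \<in> A \<times> V"
  shows "uE \<Omega> (join p) (join q) = join (unified_mult mult \<Omega> p q)"
  using assms by (auto simp: unified_on_E_def join_def split_join)

lemma join_surj: obtains p where "p \<in> A \<times> V" "e = join p"
  using proj_cases[of e] by (metis SigmaI case_prod_conv join_def)

text \<open>The bijection \<open>join\<close> carries the unified product to
  \<open>uE \<Omega>\<close>, so associativity and the unit laws correspond. The other conditions
  for membership in \<open>algs\<close>, bilinearity and agreement with \<open>mult\<close> on A,
  hold for every datum.\<close>

lemma AE_iff:
  assumes \<Omega>: "datum \<Omega>"
  shows "\<Omega> \<in> AE' \<longleftrightarrow> uE \<Omega> \<in> algs"
proof -
  let ?m = "unified_mult mult \<Omega>"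
  note mem = unified_mult_mem[OF \<Omega>]
  \<comment> \<open>Quantifiers over E become quantifiers over \<open>A \<times> V\<close>, since
    \<open>join\<close> is onto.\<close>
  have all: "(\<forall>e. P e) \<longleftrightarrow> (\<forall>p\<in>A \<times> V. P (join p))" for P :: "'e \<Rightarrow> bool"
    by (metis join_surj)
  have inj: "join p = join q \<longleftrightarrow> p = q" if "p \<in> A \<times> V" "q \<in> A \<times> V" for p q
    using inj_join that by (rule inj_on_eq_iff)
  have assoc: "(\<forall>e e' e''. uE \<Omega> (uE \<Omega> e e') e'' = uE \<Omega> e (uE \<Omega> e' e''))
      \<longleftrightarrow> (\<forall>p\<in>A \<times> V. \<forall>q\<in>A \<times> V. \<forall>t\<in>A \<times> V. ?m (?m p q) t = ?m p (?m q t))"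
    unfolding all by (intro ball_cong refl) (simp only: unified_on_E_join mem inj)
  have j1: "one = join (one, 0)" and o1: "(one, 0) \<in> A \<times> V" by (simp_all add: join_def)
  have unit: "(\<forall>e. uE \<Omega> one e = e \<and> uE \<Omega> e one = e)
      \<longleftrightarrow> (\<forall>p\<in>A \<times> V. ?m (one, 0) p = p \<and> ?m p (one, 0) = p)"
    unfolding all
    by (subst (1 2) j1) (simp add: unified_on_E_join mem inj o1 del: mem_Sigma_iff cong: ball_cong)
  \<comment> \<open>Elements of A have V-component 0, so every term except the product in A
    vanishes.\<close>
  have "uE \<Omega> a b = a \<odot> b" if "a \<in> A" "b \<in> A" for a b
    using that \<Omega> by (simp add: unified_on_E_eq)
  then show ?thesis
    using \<Omega> bilinear_unified_on_E[OF \<Omega>] assoc unit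
    by (simp add: AE_def alg_structures_def unital_algebra_on_def)
qed

section \<open>Recovering the datum from an algebra structure\<close>

text \<open>The default \<open>undefined\<close> is the value that extensionality in
  \<open>bilinear_maps\<close> prescribes, so each structure yields a genuine datum.\<close>

definition datum_of :: "('e \<Rightarrow> 'e \<Rightarrow> 'e) \<Rightarrow> 'e ext_datum" where
  "datum_of \<mu> =
    \<lparr>vact_right = (\<lambda>x a. if x \<in> V \<and> a \<in> A then pV (\<mu> x a) else undefined),
     vact_alg = (\<lambda>x a. if x \<in> V \<and> a \<in> A then pA (\<mu> x a) else undefined),
     aact_alg = (\<lambda>a x. if a \<in> A \<and> x \<in> V then pA (\<mu> a x) else undefined),
     aact_left = (\<lambda>a x. if a \<in> A \<and> x \<in> V then pV (\<mu> a x) else undefined),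
     cocyc = (\<lambda>x y. if x \<in> V \<and> y \<in> V then pA (\<mu> x y) else undefined),
     vmult = (\<lambda>x y. if x \<in> V \<and> y \<in> V then pV (\<mu> x y) else undefined)\<rparr>"

lemma datum_datum_of:
  assumes "\<mu> \<in> algs"
  shows "datum (datum_of \<mu>)"
proof -
  have "bilinear_map_on scale UNIV UNIV UNIV \<mu>"
    using assms by (simp add: alg_structures_def unital_algebra_on_def)
  note c = bilinear_map_on_comp[OF this linear_incl linear_incl]
  show ?thesis
    unfolding extending_datum_def datum_of_def ext_datum.simps
    by (intro conjI bilinear_map_on_restrict_mem[where b = "\<lambda>x y. pA (\<mu> x y)"]
        bilinear_map_on_restrict_mem[where b = "\<lambda>x y. pV (\<mu> x y)"]
        c linear_pA linear_pV subA subV module_axioms)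
qed

text \<open>Biadditivity splits a product into four pieces; the piece in \<open>A \<times> A\<close>
  is fixed by membership in \<open>algs\<close>, and the other three are rebuilt from their
  components.\<close>

lemma unified_datum_of:
  assumes "\<mu> \<in> algs"
  shows "uE (datum_of \<mu>) = \<mu>"
proof (intro ext)
  fix e e'
  have bil: "bilinear_map_on scale UNIV UNIV UNIV \<mu>" and onA: "\<And>a b. a \<in> A \<Longrightarrow> b \<in> A \<Longrightarrow> \<mu> a b = a \<odot> b"
    using assms by (simp_all add: alg_structures_def unital_algebra_on_def)
  have "\<mu> e e' = \<mu> (pA e + pV e) (pA e' + pV e')" by (simp add: pA_add_pV)
  also have "\<dots> = pA e \<odot> pA e' + \<mu> (pA e) (pV e') + \<mu> (pV e) (pA e') + \<mu> (pV e) (pV e')"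
    by (simp add: bilinear_map_onD(2,3)[OF bil] onA add_ac)
  finally have \<mu>: "\<mu> e e' = \<dots>" .
  show "uE (datum_of \<mu>) e e' = \<mu> e e'"
    unfolding eq_iff_proj[of "uE _ _ _"] \<mu> by (simp add: unified_on_E_eq datum_of_def)
qed

text \<open>On arguments from a single summand, all terms of the product but those of the given type
  contain a zero argument. Hence the product determines the datum.\<close>

lemma datum_components:
  assumes "datum \<Omega>"
  shows "x \<in> V \<Longrightarrow> a \<in> A \<Longrightarrow> x \<triangleleft>\<^bsub>\<Omega>\<^esub> a = pV (uE \<Omega> x a)"
    "x \<in> V \<Longrightarrow> a \<in> A \<Longrightarrow> x \<triangleright>\<^bsub>\<Omega>\<^esub> a = pA (uE \<Omega> x a)"
    "a \<in> A \<Longrightarrow> x \<in> V \<Longrightarrow> a \<leftharpoonup>\<^bsub>\<Omega>\<^esub> x = pA (uE \<Omega> a x)"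
    "a \<in> A \<Longrightarrow> x \<in> V \<Longrightarrow> a \<rightharpoonup>\<^bsub>\<Omega>\<^esub> x = pV (uE \<Omega> a x)"
    "x \<in> V \<Longrightarrow> y \<in> V \<Longrightarrow> cocyc \<Omega> x y = pA (uE \<Omega> x y)"
    "x \<in> V \<Longrightarrow> y \<in> V \<Longrightarrow> x \<cdot>\<^bsub>\<Omega>\<^esub> y = pV (uE \<Omega> x y)"
  using assms by (simp_all add: unified_on_E_eq)

lemma inj_unified_on_E:
  assumes "datum \<Omega>" "datum \<Omega>'" "uE \<Omega> = uE \<Omega>'"
  shows "\<Omega> = \<Omega>'"
proof -
  note D = assms(1,2)[unfolded extending_datum_def]
  note c = datum_components[OF assms(1)] datum_components[OF assms(2)]
  have "vact_right \<Omega> = vact_right \<Omega>'"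
    by (rule bilinear_maps_eqI[of _ scale V A V]) (use D assms(3) in \<open>auto simp: c\<close>)
  moreover have "vact_alg \<Omega> = vact_alg \<Omega>'"
    by (rule bilinear_maps_eqI[of _ scale V A A]) (use D assms(3) in \<open>auto simp: c\<close>)
  moreover have "aact_alg \<Omega> = aact_alg \<Omega>'"
    by (rule bilinear_maps_eqI[of _ scale A V A]) (use D assms(3) in \<open>auto simp: c\<close>)
  moreover have "aact_left \<Omega> = aact_left \<Omega>'"
    by (rule bilinear_maps_eqI[of _ scale A V V]) (use D assms(3) in \<open>auto simp: c\<close>)
  moreover have "cocyc \<Omega> = cocyc \<Omega>'"
    by (rule bilinear_maps_eqI[of _ scale V V A]) (use D assms(3) in \<open>auto simp: c\<close>)
  moreover have "vmult \<Omega> = vmult \<Omega>'"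
    by (rule bilinear_maps_eqI[of _ scale V V V]) (use D assms(3) in \<open>auto simp: c\<close>)
  ultimately show ?thesis by simp
qed

lemma bij_unified_on_E: "bij_betw uE AE' algs"
proof (rule bij_betw_imageI)
  have datum: "datum \<Omega>" if "\<Omega> \<in> AE'" for \<Omega>
    using that by (simp add: AE_def)
  then show "inj_on uE AE'"
    by (auto intro: inj_onI inj_unified_on_E)
  show "uE ` AE' = algs"
  proof (intro equalityI subsetI)
    show "\<mu> \<in> uE ` AE'" if "\<mu> \<in> algs" for \<mu>
      using that AE_iff datum_datum_of unified_datum_of by (metis imageI)
  qed (use AE_iff datum in auto)
qed

section \<open>Linear maps fixing A as pairs \<open>(r, v)\<close>\<close>

text \<open>A block triangular map for the decomposition of E: identity on A, \<open>v\<close> on V,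
  and \<open>r\<close> as the off-diagonal block.\<close>

definition glue :: "('e \<Rightarrow> 'e) \<Rightarrow> ('e \<Rightarrow> 'e) \<Rightarrow> 'e \<Rightarrow> 'e" where
  "glue r v e = pA e + r (pV e) + v (pV e)"

lemma linear_glue:
  assumes r: "linear_map_on scale V A r" and v: "linear_map_on scale V V v"
  shows "linear_map_on scale UNIV UNIV (glue r v)"
  by (simp add: linear_map_on_def glue_def linear_map_onD[OF r] linear_map_onD[OF v]
      scale_right_distrib algebra_simps)

text \<open>The diagonal block on A is the identity, so only the block \<open>v\<close> can obstruct
  bijectivity.\<close>

lemma glue_bij_iff:
  assumes r: "linear_map_on scale V A r" and v: "linear_map_on scale V V v"
  shows "bij (glue r v) \<longleftrightarrow> bij_betw v V V"
proof -
  note [simp] = linear_map_onD(1)[OF r] linear_map_onD(1)[OF v]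
  have proj [simp]: "pA (glue r v e) = pA e + r (pV e)" "pV (glue r v e) = v (pV e)" for e
    by (simp_all add: glue_def)
  show ?thesis
  proof
    assume bij: "bij (glue r v)"
    have "inj_on v V"
    proof (rule inj_onI)
      fix x y assume xy: "x \<in> V" "y \<in> V" "v x = v y"
      \<comment> \<open>The correction \<open>- r z\<close> cancels the A-component of the image, so
        that equal values of \<open>v\<close> give equal values of \<open>glue r v\<close>.\<close>
      have "glue r v (- r z + z) = v z" if "z \<in> V" for z
        using that subspace_neg[OF subA]
        by (simp only: glue_def proj_add linear_map_onD(1)[OF r]) simp
      with xy have "glue r v (- r x + x) = glue r v (- r y + y)" by simp
      then have "- r x + x = - r y + y"
        using bij by (simp add: bij_def inj_eq)
      then show "x = y"
        using xy subspace_neg[OF subA] by (metis direct_sum_eq_iff linear_map_onD(1)[OF r])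
    qed
    moreover have "v ` V = V"
    proof (intro equalityI subsetI)
      fix y assume "y \<in> V"
      obtain e where "y = glue r v e" using bij by (metis bij_pointE)
      then have "y = v (pV e)" using \<open>y \<in> V\<close> by (metis proj(2) proj_V(2))
      then show "y \<in> v ` V" by simp
    qed auto
    ultimately show "bij_betw v V V" by (simp add: bij_betw_def)
  next
    assume bij: "bij_betw v V V"
    show "bij (glue r v)"
    proof (rule bijI)
      show "inj (glue r v)"
      proof (rule injI)
        fix e e' assume eq: "glue r v e = glue r v e'"
        then have "v (pV e) = v (pV e')" by (metis proj(2))
        then have "pV e = pV e'" using bij inj_onD[of v V "pV e" "pV e'"] by (simp add: bij_betw_def)
        with eq show "e = e'" by (metis add_right_cancel eq_iff_proj proj(1))
      qed
      show "surj (glue r v)"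
        unfolding surj_def
      proof
        fix e
        obtain x where x: "x \<in> V" "v x = pV e"
          using bij by (metis bij_betw_def imageE pV_mem)
        \<comment> \<open>A preimage comes from solving for the V-component first and then
          subtracting the contribution of \<open>r\<close> from the A-component.\<close>
        have "glue r v (pA e - r x + x) = e"
          unfolding eq_iff_proj[of "glue _ _ _"] using x by simp
        then show "\<exists>e'. e = glue r v e'" by metis
      qed
    qed
  qed
qed

text \<open>By additivity \<open>\<phi>\<close> is determined by its values on A, where it is the
  identity, and on V, where its two components are \<open>r\<close> and \<open>v\<close>.\<close>

lemma stabilizes_imp_glue:
  assumes lin: "linear_map_on scale UNIV UNIV \<phi>" and st: "stabilizes A \<phi>"
  shows "\<phi> = glue (\<lambda>x. pA (\<phi> x)) (\<lambda>x. pV (\<phi> x))"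
proof
  fix e
  have "\<phi> e = \<phi> (pA e) + \<phi> (pV e)"
    by (metis UNIV_I linear_map_onD(2)[OF lin] pA_add_pV)
  also have "\<phi> (pA e) = pA e" using st by (simp add: stabilizes_def)
  finally show "\<phi> e = glue (\<lambda>x. pA (\<phi> x)) (\<lambda>x. pV (\<phi> x)) e"
    by (simp add: glue_def pA_add_pV add.assoc)
qed

lemma linear_components:
  assumes "linear_map_on scale UNIV UNIV \<phi>"
  shows "linear_map_on scale V A (\<lambda>x. pA (\<phi> x))" "linear_map_on scale V V (\<lambda>x. pV (\<phi> x))"
  using linear_map_on_comp[OF assms linear_pA] linear_map_on_comp[OF assms linear_pV]
  by (auto intro: linear_map_on_subset)

text \<open>The equations of the relation \<open>\<equiv>\<close> with \<open>v x\<close> substituted for \<open>x\<close>, so that no inverse of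
  \<open>v\<close> occurs.\<close>

definition compat :: "'e ext_datum \<Rightarrow> 'e ext_datum \<Rightarrow> ('e \<Rightarrow> 'e) \<Rightarrow> ('e \<Rightarrow> 'e) \<Rightarrow> bool" where
  "compat \<Omega> \<Omega>' r v \<longleftrightarrow>
    (\<forall>a\<in>A. \<forall>x\<in>V. a \<rightharpoonup>\<^bsub>\<Omega>'\<^esub> v x = v (a \<rightharpoonup>\<^bsub>\<Omega>\<^esub> x)) \<and>
    (\<forall>a\<in>A. \<forall>x\<in>V. a \<leftharpoonup>\<^bsub>\<Omega>'\<^esub> v x = r (a \<rightharpoonup>\<^bsub>\<Omega>\<^esub> x) - a \<odot> r x + a \<leftharpoonup>\<^bsub>\<Omega>\<^esub> x) \<and>
    (\<forall>a\<in>A. \<forall>x\<in>V. v x \<triangleleft>\<^bsub>\<Omega>'\<^esub> a = v (x \<triangleleft>\<^bsub>\<Omega>\<^esub> a)) \<and>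
    (\<forall>a\<in>A. \<forall>x\<in>V. v x \<triangleright>\<^bsub>\<Omega>'\<^esub> a = r (x \<triangleleft>\<^bsub>\<Omega>\<^esub> a) - r x \<odot> a + x \<triangleright>\<^bsub>\<Omega>\<^esub> a) \<and>
    (\<forall>x\<in>V. \<forall>y\<in>V. v x \<cdot>\<^bsub>\<Omega>'\<^esub> v y = v (x \<cdot>\<^bsub>\<Omega>\<^esub> y) - v (r x \<rightharpoonup>\<^bsub>\<Omega>\<^esub> y) - v (x \<triangleleft>\<^bsub>\<Omega>\<^esub> r y)) \<and>
    (\<forall>x\<in>V. \<forall>y\<in>V. cocyc \<Omega>' (v x) (v y) = r (x \<cdot>\<^bsub>\<Omega>\<^esub> y) + cocyc \<Omega> x y
       - r (r x \<rightharpoonup>\<^bsub>\<Omega>\<^esub> y) - r x \<leftharpoonup>\<^bsub>\<Omega>\<^esub> y - r (x \<triangleleft>\<^bsub>\<Omega>\<^esub> r y) + r x \<odot> r y - x \<triangleright>\<^bsub>\<Omega>\<^esub> r y)"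

section \<open>Multiplicativity of glued maps\<close>

text \<open>Both sides of the identity are additive in each argument, and every vector is a sum of
  one from A and one from V.\<close>

lemma multiplicative_iff_pieces:
  assumes b: "bilinear_map_on scale UNIV UNIV UNIV \<mu>" and b': "bilinear_map_on scale UNIV UNIV UNIV \<mu>'"
    and lin: "linear_map_on scale UNIV UNIV \<phi>"
  shows "(\<forall>e e'. \<phi> (\<mu> e e') = \<mu>' (\<phi> e) (\<phi> e')) \<longleftrightarrow>
    (\<forall>e\<in>A \<union> V. \<forall>e'\<in>A \<union> V. \<phi> (\<mu> e e') = \<mu>' (\<phi> e) (\<phi> e'))" (is "_ \<longleftrightarrow> ?R")
proof
  assume R: ?R
  show "\<forall>e e'. \<phi> (\<mu> e e') = \<mu>' (\<phi> e) (\<phi> e')"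
  proof (intro allI)
    fix e e'
    obtain a x where e: "a \<in> A" "x \<in> V" "e = a + x" by (rule proj_cases)
    obtain b y where e': "b \<in> A" "y \<in> V" "e' = b + y" by (rule proj_cases)
    show "\<phi> (\<mu> e e') = \<mu>' (\<phi> e) (\<phi> e')"
      using R e e' by (simp add: bilinear_map_onD(2,3)[OF b] bilinear_map_onD(2,3)[OF b'] linear_map_onD(2)[OF lin])
  qed
qed simp

text \<open>Multiplicativity is tested on the four pairs of summands. The pair A, A gives no
  condition; each other pair gives two equations, one per component, and together these are the six
  of \<open>compat\<close>.\<close>

lemma glue_multiplicative_iff:
  assumes \<Omega>: "datum \<Omega>" and \<Omega>': "datum \<Omega>'"
    and r: "linear_map_on scale V A r" and v: "linear_map_on scale V V v"
  shows "(\<forall>e e'. glue r v (uE \<Omega> e e') = uE \<Omega>' (glue r v e) (glue r v e')) \<longleftrightarrow> compat \<Omega> \<Omega>' r v"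
proof -
  let ?\<phi> = "glue r v"
  note [simp] = \<Omega> \<Omega>' linear_map_onD(1)[OF r] linear_map_onD(1)[OF v]
  have z [simp]: "r 0 = 0" "v 0 = 0"
    using linear_map_onD(2)[OF r, of 0 0] linear_map_onD(2)[OF v, of 0 0] by simp_all
  let ?AV = "\<lambda>a x. a \<leftharpoonup>\<^bsub>\<Omega>'\<^esub> v x = r (a \<rightharpoonup>\<^bsub>\<Omega>\<^esub> x) - a \<odot> r x + a \<leftharpoonup>\<^bsub>\<Omega>\<^esub> x \<and> a \<rightharpoonup>\<^bsub>\<Omega>'\<^esub> v x = v (a \<rightharpoonup>\<^bsub>\<Omega>\<^esub> x)"
  let ?VA = "\<lambda>a x. v x \<triangleright>\<^bsub>\<Omega>'\<^esub> a = r (x \<triangleleft>\<^bsub>\<Omega>\<^esub> a) - r x \<odot> a + x \<triangleright>\<^bsub>\<Omega>\<^esub> a \<and> v x \<triangleleft>\<^bsub>\<Omega>'\<^esub> a = v (x \<triangleleft>\<^bsub>\<Omega>\<^esub> a)"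
  let ?VV = "\<lambda>x y. cocyc \<Omega>' (v x) (v y) = r (x \<cdot>\<^bsub>\<Omega>\<^esub> y) + cocyc \<Omega> x y
       - r (r x \<rightharpoonup>\<^bsub>\<Omega>\<^esub> y) - r x \<leftharpoonup>\<^bsub>\<Omega>\<^esub> y - r (x \<triangleleft>\<^bsub>\<Omega>\<^esub> r y) + r x \<odot> r y - x \<triangleright>\<^bsub>\<Omega>\<^esub> r y \<and>
      v x \<cdot>\<^bsub>\<Omega>'\<^esub> v y = v (x \<cdot>\<^bsub>\<Omega>\<^esub> y) - v (r x \<rightharpoonup>\<^bsub>\<Omega>\<^esub> y) - v (x \<triangleleft>\<^bsub>\<Omega>\<^esub> r y)"
  have AA: "?\<phi> (uE \<Omega> a b) = uE \<Omega>' (?\<phi> a) (?\<phi> b)" if "a \<in> A" "b \<in> A" for a b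
    using that by (simp add: glue_def unified_on_E_eq)
  have AV: "?\<phi> (uE \<Omega> a x) = uE \<Omega>' (?\<phi> a) (?\<phi> x) \<longleftrightarrow> ?AV a x" if "a \<in> A" "x \<in> V" for a x
    using that unfolding eq_iff_proj[of "?\<phi> _"] by (auto simp: glue_def unified_on_E_eq algebra_simps)
  have VA: "?\<phi> (uE \<Omega> x a) = uE \<Omega>' (?\<phi> x) (?\<phi> a) \<longleftrightarrow> ?VA a x" if "a \<in> A" "x \<in> V" for a x
    using that unfolding eq_iff_proj[of "?\<phi> _"] by (auto simp: glue_def unified_on_E_eq algebra_simps)
  \<comment> \<open>Unlike the mixed cases, this equivalence holds only once the mixed equations are
    known.\<close>
  have VV: "?\<phi> (uE \<Omega> x y) = uE \<Omega>' (?\<phi> x) (?\<phi> y) \<longleftrightarrow> ?VV x y"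
    if eqs: "\<forall>a\<in>A. \<forall>x\<in>V. ?AV a x" "\<forall>a\<in>A. \<forall>x\<in>V. ?VA a x" and xy: "x \<in> V" "y \<in> V" for x y
  proof -
    \<comment> \<open>Multiplying images of vectors of V involves the primed actions of
      \<open>r x\<close> and \<open>r y\<close>; the mixed equations at these elements of A rewrite
      them in unprimed operations.\<close>
    have act: "r x \<leftharpoonup>\<^bsub>\<Omega>'\<^esub> v y = r (r x \<rightharpoonup>\<^bsub>\<Omega>\<^esub> y) - r x \<odot> r y + r x \<leftharpoonup>\<^bsub>\<Omega>\<^esub> y"
      "v x \<triangleright>\<^bsub>\<Omega>'\<^esub> r y = r (x \<triangleleft>\<^bsub>\<Omega>\<^esub> r y) - r x \<odot> r y + x \<triangleright>\<^bsub>\<Omega>\<^esub> r y"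
      "r x \<rightharpoonup>\<^bsub>\<Omega>'\<^esub> v y = v (r x \<rightharpoonup>\<^bsub>\<Omega>\<^esub> y)" "v x \<triangleleft>\<^bsub>\<Omega>'\<^esub> r y = v (x \<triangleleft>\<^bsub>\<Omega>\<^esub> r y)"
      using eqs xy by simp_all
    have "?\<phi> (uE \<Omega> x y) = uE \<Omega>' (?\<phi> x) (?\<phi> y) \<longleftrightarrow>
        cocyc \<Omega> x y + r (x \<cdot>\<^bsub>\<Omega>\<^esub> y)
          = r x \<odot> r y + r x \<leftharpoonup>\<^bsub>\<Omega>'\<^esub> v y + v x \<triangleright>\<^bsub>\<Omega>'\<^esub> r y + cocyc \<Omega>' (v x) (v y) \<and>
        v (x \<cdot>\<^bsub>\<Omega>\<^esub> y) = r x \<rightharpoonup>\<^bsub>\<Omega>'\<^esub> v y + v x \<triangleleft>\<^bsub>\<Omega>'\<^esub> r y + v x \<cdot>\<^bsub>\<Omega>'\<^esub> v y"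
      using xy unfolding eq_iff_proj[of "?\<phi> _"] by (simp add: glue_def unified_on_E_eq)
    also have "\<dots> \<longleftrightarrow> ?VV x y"
      unfolding act
      by (auto simp: algebra_simps)
    finally show ?thesis .
  qed
  have "(\<forall>e e'. ?\<phi> (uE \<Omega> e e') = uE \<Omega>' (?\<phi> e) (?\<phi> e')) \<longleftrightarrow>
      (\<forall>a\<in>A. \<forall>x\<in>V. ?\<phi> (uE \<Omega> a x) = uE \<Omega>' (?\<phi> a) (?\<phi> x)) \<and>
      (\<forall>a\<in>A. \<forall>x\<in>V. ?\<phi> (uE \<Omega> x a) = uE \<Omega>' (?\<phi> x) (?\<phi> a)) \<and>
      (\<forall>x\<in>V. \<forall>y\<in>V. ?\<phi> (uE \<Omega> x y) = uE \<Omega>' (?\<phi> x) (?\<phi> y))"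
    unfolding multiplicative_iff_pieces[OF bilinear_unified_on_E[OF \<Omega>] bilinear_unified_on_E[OF \<Omega>']
        linear_glue[OF r v]]
    using AA by blast
  also have "\<dots> \<longleftrightarrow> (\<forall>a\<in>A. \<forall>x\<in>V. ?AV a x) \<and> (\<forall>a\<in>A. \<forall>x\<in>V. ?VA a x) \<and> (\<forall>x\<in>V. \<forall>y\<in>V. ?VV x y)"
    \<comment> \<open>The congruence rule for conjunctions makes the mixed equations available as
      assumptions when \<open>VV\<close> is applied.\<close>
    by (intro conj_cong[OF ball_cong[OF refl ball_cong[OF refl AV]]
          conj_cong[OF ball_cong[OF refl ball_cong[OF refl VA]]
            ball_cong[OF refl ball_cong[OF refl VV]]]])
  also have "\<dots> \<longleftrightarrow> compat \<Omega> \<Omega>' r v"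
    unfolding compat_def ball_conj_distrib by argo
  finally show ?thesis .
qed

section \<open>The relations on data as pullbacks of those on algebra structures\<close>

lemma AE_equiv_iff:
  "(\<Omega>, \<Omega>') \<in> AE_equiv scale A V mult one \<longleftrightarrow> \<Omega> \<in> AE' \<and> \<Omega>' \<in> AE' \<and>
    (\<exists>r v. linear_map_on scale V A r \<and> linear_map_on scale V V v \<and> bij_betw v V V \<and> compat \<Omega> \<Omega>' r v)"
proof -
  \<comment> \<open>Since \<open>v\<close> permutes V, a variable ranging over V may be replaced by
    \<open>v x\<close>; then \<open>w (v x)\<close> collapses to \<open>x\<close> and the inverse
    disappears.\<close>
  have reindex: "(\<forall>x\<in>V. P x) \<longleftrightarrow> (\<forall>x\<in>V. Q x)"
    if "bij_betw v V V" "\<And>x. x \<in> V \<Longrightarrow> P (v x) = Q x" for P Q and v :: "'e \<Rightarrow> 'e"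
    using that unfolding bij_betw_def by (metis imageE imageI)
  show ?thesis
    unfolding AE_equiv_def compat_def Let_def mem_Collect_eq case_prod_conv
    by (intro conj_cong refl ex_cong1;
        (rule ball_cong[OF refl[of A]])?; (rule reindex, assumption)+;
        simp add: the_inv_into_f_f bij_betw_def)
qed

text \<open>This is \<open>compat\<close> with \<open>v\<close> the identity: by extensionality,
  equality of the two V-valued actions as functions is the same as their pointwise
  equations.\<close>

lemma AE_cohom_iff:
  "(\<Omega>, \<Omega>') \<in> AE_cohom scale A V mult one \<longleftrightarrow> \<Omega> \<in> AE' \<and> \<Omega>' \<in> AE' \<and>
    (\<exists>r. linear_map_on scale V A r \<and> compat \<Omega> \<Omega>' r (\<lambda>x. x))"
proof -
  have "vact_right \<Omega>' = vact_right \<Omega> \<longleftrightarrow> (\<forall>a\<in>A. \<forall>x\<in>V. x \<triangleleft>\<^bsub>\<Omega>'\<^esub> a = x \<triangleleft>\<^bsub>\<Omega>\<^esub> a)"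
    "aact_left \<Omega>' = aact_left \<Omega> \<longleftrightarrow> (\<forall>a\<in>A. \<forall>x\<in>V. a \<rightharpoonup>\<^bsub>\<Omega>'\<^esub> x = a \<rightharpoonup>\<^bsub>\<Omega>\<^esub> x)"
    if "\<Omega> \<in> AE'" "\<Omega>' \<in> AE'"
    using that
    by (auto simp: AE_def extending_datum_def intro: bilinear_maps_eqI[of _ scale V A V]
        bilinear_maps_eqI[of _ scale A V V])
  then show ?thesis
    unfolding AE_cohom_def compat_def by auto
qed

text \<open>As \<open>r\<close> maps into A and \<open>\<Omega>\<close> is a datum, \<open>v\<close>
  is only ever evaluated on V. This lets a \<open>v\<close> known only on V be exchanged for the
  identity.\<close>

lemma compat_cong:
  assumes "datum \<Omega>" "linear_map_on scale V A r" "\<And>x. x \<in> V \<Longrightarrow> v x = v' x"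
  shows "compat \<Omega> \<Omega>' r v \<longleftrightarrow> compat \<Omega> \<Omega>' r v'"
  unfolding compat_def using assms by (simp add: linear_map_onD(1)[OF assms(2)] cong: ball_cong)

lemma algebra_iso_linear: "algebra_iso scale one \<mu> \<mu>' \<phi> \<Longrightarrow> linear_map_on scale UNIV UNIV \<phi>"
  by (simp add: algebra_iso_def linear_iff_map_on)

text \<open>The unit lies in A and is therefore fixed by any glued map, leaving bijectivity and
  multiplicativity.\<close>

lemma algebra_iso_glue_iff:
  assumes "datum \<Omega>" "datum \<Omega>'" "linear_map_on scale V A r" "linear_map_on scale V V v"
  shows "algebra_iso scale one (uE \<Omega>) (uE \<Omega>') (glue r v) \<longleftrightarrow> bij_betw v V V \<and> compat \<Omega> \<Omega>' r v"
proof -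
  have "r 0 = 0" "v 0 = 0"
    using linear_map_onD(2)[OF assms(3), of 0 0] linear_map_onD(2)[OF assms(4), of 0 0] by simp_all
  then have "glue r v one = one" by (simp add: glue_def)
  then show ?thesis
    using assms
    by (simp add: algebra_iso_def linear_iff_map_on linear_glue glue_bij_iff glue_multiplicative_iff)
qed

text \<open>The predicate \<open>Q\<close> is left open so that the same change of variables serves
  both relations; for the second one it includes co-stabilization.\<close>

lemma ex_stabilizing_iff:
  assumes "\<And>\<phi>. Q \<phi> \<Longrightarrow> linear_map_on scale UNIV UNIV \<phi>"
  shows "(\<exists>\<phi>. Q \<phi> \<and> stabilizes A \<phi>) \<longleftrightarrow>
    (\<exists>r v. linear_map_on scale V A r \<and> linear_map_on scale V V v \<and> Q (glue r v))"
proof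
  assume "\<exists>\<phi>. Q \<phi> \<and> stabilizes A \<phi>"
  then show "\<exists>r v. linear_map_on scale V A r \<and> linear_map_on scale V V v \<and> Q (glue r v)"
    using assms stabilizes_imp_glue linear_components by metis
next
  assume "\<exists>r v. linear_map_on scale V A r \<and> linear_map_on scale V V v \<and> Q (glue r v)"
  then obtain r v where rv: "linear_map_on scale V A r" "linear_map_on scale V V v" "Q (glue r v)"
    by blast
  have "r 0 = 0" "v 0 = 0"
    using linear_map_onD(2)[OF rv(1), of 0 0] linear_map_onD(2)[OF rv(2), of 0 0] by simp_all
  then have "stabilizes A (glue r v)" by (simp add: stabilizes_def glue_def)
  with rv show "\<exists>\<phi>. Q \<phi> \<and> stabilizes A \<phi>" by blast
qed

lemma co_stabilizes_glue_iff:
  assumes "linear_map_on scale V A r" "linear_map_on scale V V v"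
  shows "co_stabilizes A V (glue r v) \<longleftrightarrow> (\<forall>x\<in>V. v x = x)"
proof -
  have "pV (glue r v e) = v (pV e)" for e
    using linear_map_onD(1)[OF assms(1)] linear_map_onD(1)[OF assms(2)] by (simp add: glue_def)
  then show ?thesis
    by (simp add: co_stabilizes_def fun_eq_iff) (metis pV_mem proj_V(2))
qed

lemma AE_mem: "\<Omega> \<in> AE' \<Longrightarrow> datum \<Omega>" "\<Omega> \<in> AE' \<Longrightarrow> uE \<Omega> \<in> algs"
  using AE_iff by (auto simp: AE_def)

text \<open>An isomorphism stabilizing A is a glued map, for which bijectivity and multiplicativity
  have become conditions on \<open>(r, v)\<close>.\<close>

lemma AE_equiv_pullback:
  "AE_equiv scale A V mult one =
    {(\<Omega>, \<Omega>'). \<Omega> \<in> AE' \<and> \<Omega>' \<in> AE' \<and> (uE \<Omega>, uE \<Omega>') \<in> alg_equivalent scale A mult one}"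
proof -
  have "(\<exists>\<phi>. algebra_iso scale one (uE \<Omega>) (uE \<Omega>') \<phi> \<and> stabilizes A \<phi>) \<longleftrightarrow>
      (\<exists>r v. linear_map_on scale V A r \<and> linear_map_on scale V V v \<and> bij_betw v V V \<and> compat \<Omega> \<Omega>' r v)"
    if "datum \<Omega>" "datum \<Omega>'" for \<Omega> \<Omega>'
    by (subst ex_stabilizing_iff)
      (use that algebra_iso_glue_iff algebra_iso_linear in \<open>blast+\<close>)
  then show ?thesis
    unfolding alg_equivalent_def set_eq_iff split_paired_All mem_Collect_eq case_prod_conv
      AE_equiv_iff
    using AE_mem by (intro allI) blast
qed

lemma AE_cohom_pullback:
  "AE_cohom scale A V mult one =
    {(\<Omega>, \<Omega>'). \<Omega> \<in> AE' \<and> \<Omega>' \<in> AE' \<and> (uE \<Omega>, uE \<Omega>') \<in> alg_cohomologous scale A V mult one}"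
proof -
  \<comment> \<open>The conjuncts are grouped so that co-stabilization belongs to the predicate
    \<open>Q\<close> of \<open>ex_stabilizing_iff\<close>.\<close>
  have "(\<exists>\<phi>. (algebra_iso scale one (uE \<Omega>) (uE \<Omega>') \<phi> \<and> co_stabilizes A V \<phi>) \<and> stabilizes A \<phi>) \<longleftrightarrow>
      (\<exists>r. linear_map_on scale V A r \<and> compat \<Omega> \<Omega>' r (\<lambda>x. x))" (is "?L \<longleftrightarrow> ?R")
    if \<Omega>: "datum \<Omega>" "datum \<Omega>'" for \<Omega> \<Omega>'
  proof -
    have "?L \<longleftrightarrow> (\<exists>r v. linear_map_on scale V A r \<and> linear_map_on scale V V v \<and>
        (\<forall>x\<in>V. v x = x) \<and> bij_betw v V V \<and> compat \<Omega> \<Omega>' r v)"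
      by (subst ex_stabilizing_iff)
        (use \<Omega> algebra_iso_glue_iff co_stabilizes_glue_iff algebra_iso_linear in \<open>blast+\<close>)
    also have "\<dots> \<longleftrightarrow> ?R"
    proof
      assume ?R
      moreover have "linear_map_on scale V V (\<lambda>x. x)" "bij_betw (\<lambda>x. x) V V"
        by (simp_all add: linear_map_on_def bij_betw_def)
      ultimately show "\<exists>r v. linear_map_on scale V A r \<and> linear_map_on scale V V v \<and>
        (\<forall>x\<in>V. v x = x) \<and> bij_betw v V V \<and> compat \<Omega> \<Omega>' r v" by blast
    \<comment> \<open>For the forward direction, \<open>v\<close> agrees with the identity on V and
      is replaced by it through \<open>compat_cong\<close>.\<close>
    qed (metis (no_types, lifting) compat_cong[OF \<Omega>(1)])
    finally show ?thesis .
  qed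
  then show ?thesis
    unfolding alg_cohomologous_def set_eq_iff split_paired_All mem_Collect_eq case_prod_conv
      AE_cohom_iff
    using AE_mem by (intro allI) blast
qed

section \<open>Equivalence and cohomology of algebra structures as equivalence relations\<close>

lemma algebra_iso_id: "algebra_iso scale one \<mu> \<mu> (\<lambda>x. x)"
  by (simp add: algebra_iso_def linear_iff_map_on linear_incl bij_def surj_def)

lemma algebra_iso_comp:
  assumes "algebra_iso scale one \<mu> \<mu>' \<phi>" "algebra_iso scale one \<mu>' \<mu>'' \<psi>"
  shows "algebra_iso scale one \<mu> \<mu>'' (\<psi> \<circ> \<phi>)"
  using assms
  by (auto simp: algebra_iso_def linear_iff_map_on linear_map_on_def intro: bij_comp)

lemma algebra_iso_inv:
  assumes "algebra_iso scale one \<mu> \<mu>' \<phi>"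
  shows "algebra_iso scale one \<mu>' \<mu> (inv \<phi>)"
proof -
  have lin: "linear_map_on scale UNIV UNIV \<phi>" and bij: "bij \<phi>"
    and hom: "\<And>e e'. \<phi> (\<mu> e e') = \<mu>' (\<phi> e) (\<phi> e')" and one: "\<phi> one = one"
    using assms by (auto simp: algebra_iso_def linear_iff_map_on)
  have f: "\<phi> (inv \<phi> e) = e" for e using bij by (simp add: bij_def surj_f_inv_f)
  \<comment> \<open>This moves \<open>inv \<phi>\<close> across equations, reducing the laws for the
    inverse to those for \<open>\<phi>\<close>.\<close>
  have g: "inv \<phi> e = e' \<longleftrightarrow> e = \<phi> e'" for e e' using bij by (metis bij_inv_eq_iff)
  show ?thesis
    using bij_imp_bij_inv[OF bij] linear_map_onD(2,3)[OF lin]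
    by (simp add: algebra_iso_def linear_iff_map_on linear_map_on_def g f hom one)
qed

lemma stabilizes_inv: "bij \<phi> \<Longrightarrow> stabilizes A \<phi> \<Longrightarrow> stabilizes A (inv \<phi>)"
  by (metis bij_inv_eq_iff stabilizes_def)

text \<open>Composing \<open>proj_V \<circ> \<phi> = proj_V\<close> on the right with the inverse of
  \<open>\<phi>\<close> gives the claim.\<close>

lemma co_stabilizes_inv: "bij \<phi> \<Longrightarrow> co_stabilizes A V \<phi> \<Longrightarrow> co_stabilizes A V (inv \<phi>)"
  unfolding co_stabilizes_def by (metis bij_def comp_assoc comp_id surj_iff)

lemma equiv_alg_equivalent: "equiv algs (alg_equivalent scale A mult one)"
proof (rule equivI)
  show "alg_equivalent scale A mult one \<subseteq> algs \<times> algs"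
    by (auto simp: alg_equivalent_def)
  show "refl_on algs (alg_equivalent scale A mult one)"
    using algebra_iso_id by (fastforce simp: refl_on_def alg_equivalent_def stabilizes_def)
  show "sym (alg_equivalent scale A mult one)"
  proof (rule symI)
    fix \<mu> \<mu>'
    assume "(\<mu>, \<mu>') \<in> alg_equivalent scale A mult one"
    then obtain \<phi> where "\<mu> \<in> algs" "\<mu>' \<in> algs" "algebra_iso scale one \<mu> \<mu>' \<phi>" "stabilizes A \<phi>"
      by (auto simp: alg_equivalent_def)
    moreover from this have "bij \<phi>" by (simp add: algebra_iso_def)
    ultimately show "(\<mu>', \<mu>) \<in> alg_equivalent scale A mult one"
      unfolding alg_equivalent_def using algebra_iso_inv stabilizes_inv by blast
  qed
  show "trans (alg_equivalent scale A mult one)"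
  proof (rule transI)
    fix \<mu> \<mu>' \<mu>''
    assume "(\<mu>, \<mu>') \<in> alg_equivalent scale A mult one" "(\<mu>', \<mu>'') \<in> alg_equivalent scale A mult one"
    then obtain \<phi> \<psi> where "\<mu> \<in> algs" "\<mu>'' \<in> algs" "stabilizes A \<phi>" "stabilizes A \<psi>"
      "algebra_iso scale one \<mu> \<mu>' \<phi>" "algebra_iso scale one \<mu>' \<mu>'' \<psi>"
      by (auto simp: alg_equivalent_def)
    moreover from this have "stabilizes A (\<psi> \<circ> \<phi>)" by (simp add: stabilizes_def)
    ultimately show "(\<mu>, \<mu>'') \<in> alg_equivalent scale A mult one"
      unfolding alg_equivalent_def using algebra_iso_comp by blast
  qed
qed

lemma equiv_alg_cohomologous: "equiv algs (alg_cohomologous scale A V mult one)"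
proof (rule equivI)
  show "alg_cohomologous scale A V mult one \<subseteq> algs \<times> algs"
    by (auto simp: alg_cohomologous_def)
  have "stabilizes A (\<lambda>x. x)" "co_stabilizes A V (\<lambda>x. x)"
    by (auto simp: stabilizes_def co_stabilizes_def)
  then show "refl_on algs (alg_cohomologous scale A V mult one)"
    using algebra_iso_id by (auto simp: refl_on_def alg_cohomologous_def)
  show "sym (alg_cohomologous scale A V mult one)"
  proof (rule symI)
    fix \<mu> \<mu>'
    assume "(\<mu>, \<mu>') \<in> alg_cohomologous scale A V mult one"
    then obtain \<phi> where "\<mu> \<in> algs" "\<mu>' \<in> algs" "algebra_iso scale one \<mu> \<mu>' \<phi>"
      "stabilizes A \<phi>" "co_stabilizes A V \<phi>"
      by (auto simp: alg_cohomologous_def)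
    moreover from this have "bij \<phi>" by (simp add: algebra_iso_def)
    ultimately show "(\<mu>', \<mu>) \<in> alg_cohomologous scale A V mult one"
      unfolding alg_cohomologous_def
      using algebra_iso_inv stabilizes_inv co_stabilizes_inv by blast
  qed
  show "trans (alg_cohomologous scale A V mult one)"
  proof (rule transI)
    fix \<mu> \<mu>' \<mu>''
    assume "(\<mu>, \<mu>') \<in> alg_cohomologous scale A V mult one"
      "(\<mu>', \<mu>'') \<in> alg_cohomologous scale A V mult one"
    then obtain \<phi> \<psi> where "\<mu> \<in> algs" "\<mu>'' \<in> algs" "stabilizes A \<phi>" "stabilizes A \<psi>"
      "co_stabilizes A V \<phi>" "co_stabilizes A V \<psi>"
      "algebra_iso scale one \<mu> \<mu>' \<phi>" "algebra_iso scale one \<mu>' \<mu>'' \<psi>"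
      by (auto simp: alg_cohomologous_def)
    moreover from this have "stabilizes A (\<psi> \<circ> \<phi>)" "co_stabilizes A V (\<psi> \<circ> \<phi>)"
      by (simp_all add: stabilizes_def co_stabilizes_def flip: comp_assoc)
    ultimately show "(\<mu>, \<mu>'') \<in> alg_cohomologous scale A V mult one"
      unfolding alg_cohomologous_def using algebra_iso_comp by blast
  qed
qed

end

theorem theorem1p8:
  fixes scale :: "'k::field \<Rightarrow> 'e::ab_group_add \<Rightarrow> 'e"
    and A V :: "'e set"
    and mult :: "'e \<Rightarrow> 'e \<Rightarrow> 'e"
    and one :: 'e
  assumes "vector_space scale"
    and "module.subspace scale A"
    and "unital_algebra_on scale A mult one"
    and "module.subspace scale V"
    and "A \<inter> V = {0}"
    and "{a + x | a x. a \<in> A \<and> x \<in> V} = UNIV"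
  shows "(equiv (AE scale A V mult one) (AE_equiv scale A V mult one) \<and>
          (\<exists>F. (\<forall>\<Omega>\<in>AE scale A V mult one.
                   F (AE_equiv scale A V mult one `` {\<Omega>})
                   = alg_equivalent scale A mult one `` {unified_on_E A V mult \<Omega>}) \<and>
               bij_betw F (AH2_A scale A V mult one) (Extd scale A mult one)))
       \<and> (equiv (AE scale A V mult one) (AE_cohom scale A V mult one) \<and>
          (\<exists>F. (\<forall>\<Omega>\<in>AE scale A V mult one.
                   F (AE_cohom scale A V mult one `` {\<Omega>})
                   = alg_cohomologous scale A V mult one `` {unified_on_E A V mult \<Omega>}) \<and>
               bij_betw F (AH2 scale A V mult one) (Extd' scale A V mult one)))"
proof -
  interpret complemented_subalgebra scale A V mult one
    using assms by (simp add: complemented_subalgebra_def complemented_subalgebra_axioms_def)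
  show ?thesis
    unfolding AH2_A_def AH2_def Extd_def Extd'_def
    \<comment> \<open>Both halves transport along the same bijection \<open>uE\<close> and differ
      only in the relation that is pulled back.\<close>
    by (intro conjI[of "_ \<and> _"]
        quotient_bij_of_pullback[OF bij_unified_on_E equiv_alg_equivalent AE_equiv_pullback]
        quotient_bij_of_pullback[OF bij_unified_on_E equiv_alg_cohomologous AE_cohom_pullback])
qed

end
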